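(* Let $S_1,S_2\subseteq\mathbb{Z}^{+}$. Let $L_{S_1,S_2}(x,y)$ be the double exponential generating function of $(S_1,S_2)$-restricted lonesum matrices without all-zero rows and columns, i.e. $$L_{S_1,S_2}(x,y)=\sum_{M\in\mathcal{L}_{S_1,S_2}}\frac{x^{r(M)}}{r(M)!}\frac{y^{c(M)}}{c(M)!},$$ where $\mathcal{L}_{S_1,S_2}$ is the set of all such matrices (of all sizes) and $r(M)$, $c(M)$ are the numbers of rows and columns of $M$. Then, as formal power series, $$L_{S_1,S_2}(x,y)=\frac{1}{1-E_{S_1}(x)E_{S_2}(y)}.$$
   Context: $\mathbb{Z}^{+}$ is the set of positive integers. For $S\subseteq\mathbb{Z}^{+}$, $E_S(x)=\sum_{s\in S}\frac{x^s}{s!}$. A lonesum matrix is a $(0,1)$-matrix that is uniquely determined, among $(0,1)$-matrices of the same size, by its row sum vector and column sum vector. Two rows (resp. columns) of a matrix have the same type if they coincide in every position. A lonesum matrix is $(S_1,S_2)$-restricted if for every row occurring in it, the number of rows of the same type belongs to $S_1$, and for every column occurring in it, the number of columns of the same type belongs to $S_2$. Convention for empty matrices: for each $n,k$ with $nk=0$ there is exactly one $n\times k$ matrix, and it is lonesum; all rows of an $n\times 0$ matrix and all columns of a $0\times k$ matrix count as all-zero (so the $0\times 0$ matrix is the only empty matrix without all-zero rows and columns). *)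

theory Defs
  imports
    "Jordan_Normal_Form.Matrix"
    "HOL-Computational_Algebra.Formal_Power_Series"
begin

text \<open>
  For every \<open>n\<close> and \<open>k\<close> with \<open>n * k = 0\<close> there is exactly one element of \<open>carrier_mat n k\<close>, and
  these empty matrices are distinct for distinct \<open>(n, k)\<close>. All rows of an \<open>n \<times> 0\<close> matrix equal
  \<open>0\<^sub>v 0\<close>, and likewise for the columns of a \<open>0 \<times> k\<close> matrix.
\<close>

definition zero_one_mat :: "nat mat \<Rightarrow> bool" where
  "zero_one_mat A \<longleftrightarrow> elements_mat A \<subseteq> {0, 1}"

definition row_sums :: "nat mat \<Rightarrow> nat vec" where
  "row_sums A = vec (dim_row A) (\<lambda>i. \<Sum>j<dim_col A. A $$ (i, j))"

definition col_sums :: "nat mat \<Rightarrow> nat vec" where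
  "col_sums A = vec (dim_col A) (\<lambda>j. \<Sum>i<dim_row A. A $$ (i, j))"

definition lonesum :: "nat mat \<Rightarrow> bool" where
  "lonesum A \<longleftrightarrow> zero_one_mat A \<and>
     (\<forall>B \<in> carrier_mat (dim_row A) (dim_col A).
        zero_one_mat B \<and> row_sums B = row_sums A \<and> col_sums B = col_sums A \<longrightarrow> B = A)"

definition type_restricted :: "nat set \<Rightarrow> nat set \<Rightarrow> nat mat \<Rightarrow> bool" where
  "type_restricted S1 S2 A \<longleftrightarrow>
     (\<forall>i < dim_row A. card {i'. i' < dim_row A \<and> row A i' = row A i} \<in> S1) \<and>
     (\<forall>j < dim_col A. card {j'. j' < dim_col A \<and> col A j' = col A j} \<in> S2)"

definition no_zero_row_col :: "nat mat \<Rightarrow> bool" where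
  "no_zero_row_col A \<longleftrightarrow>
     (\<forall>i < dim_row A. row A i \<noteq> 0\<^sub>v (dim_col A)) \<and>
     (\<forall>j < dim_col A. col A j \<noteq> 0\<^sub>v (dim_row A))"

definition restricted_lonesum :: "nat set \<Rightarrow> nat set \<Rightarrow> nat mat set" where
  "restricted_lonesum S1 S2 = {A. lonesum A \<and> type_restricted S1 S2 A \<and> no_zero_row_col A}"

text \<open>
  Power series in \<open>x\<close> and \<open>y\<close> are represented as power series in \<open>x\<close> whose coefficients are
  power series in \<open>y\<close>; the coefficient of \<open>x^n y^k\<close> in \<open>F\<close> is \<open>fps_nth (fps_nth F n) k\<close>.
\<close>

definition in_x :: "'a::zero fps \<Rightarrow> 'a fps fps" where
  "in_x f = Abs_fps (\<lambda>n. fps_const (fps_nth f n))"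

definition in_y :: "'a::zero fps \<Rightarrow> 'a fps fps" where
  "in_y f = fps_const f"

definition set_egf :: "nat set \<Rightarrow> 'a::field_char_0 fps" where
  "set_egf S = Abs_fps (\<lambda>s. if s \<in> S then 1 / fact s else 0)"

text \<open>
  The formal sum over all matrices is taken coefficientwise: \<open>M\<close> contributes only to the
  coefficient of \<open>x^n y^k\<close> with \<open>n\<close> and \<open>k\<close> its numbers of rows and columns. Each of these
  sums is finite, see \<open>finite_restricted_lonesum\<close>.
\<close>

definition lonesum_egf :: "nat set \<Rightarrow> nat set \<Rightarrow> 'a::field_char_0 fps fps" where
  "lonesum_egf S1 S2 = Abs_fps (\<lambda>n. Abs_fps (\<lambda>k.
     \<Sum>M \<in> {M \<in> restricted_lonesum S1 S2. dim_row M = n \<and> dim_col M = k}.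
       1 / fact (dim_row M) * (1 / fact (dim_col M))))"

lemma finite_restricted_lonesum:
  "finite {M \<in> restricted_lonesum S1 S2. dim_row M = n \<and> dim_col M = k}"
proof (rule finite_subset)
  let ?m = "\<lambda>S. mat n k (\<lambda>p. if p \<in> S then 1 else 0 :: nat)"
  show "{M \<in> restricted_lonesum S1 S2. dim_row M = n \<and> dim_col M = k}
          \<subseteq> ?m ` Pow ({..<n} \<times> {..<k})"
  proof
    fix M assume "M \<in> {M \<in> restricted_lonesum S1 S2. dim_row M = n \<and> dim_col M = k}"
    then have e: "elements_mat M \<subseteq> {0, 1}" and d: "dim_row M = n" "dim_col M = k"
      by (auto simp: restricted_lonesum_def lonesum_def zero_one_mat_def)
    let ?S = "{(i, j). i < n \<and> j < k \<and> M $$ (i, j) = 1}"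
    have "M $$ (i, j) = 0 \<or> M $$ (i, j) = 1" if "i < n" "j < k" for i j
      using e elements_matI[of M n k i j] that d by blast
    then have "M = ?m ?S"
      using d by (intro eq_matI) auto
    then show "M \<in> ?m ` Pow ({..<n} \<times> {..<k})"
      by (intro image_eqI[of _ _ ?S]) auto
  qed
qed auto

text \<open>
  The coefficient ring \<open>'a fps\<close> is not a field, so \<open>inverse\<close> and \<open>/\<close> on \<open>'a fps fps\<close> are only
  meaningful for suitable arguments. Here the coefficient of \<open>x^0\<close> is \<open>1\<close>, and \<open>/\<close> is a true
  quotient.
\<close>

lemma one_minus_set_egf_unit:
  fixes S1 S2 :: "nat set"
  assumes "S1 \<subseteq> {0<..}"
  defines "F \<equiv> 1 - in_x (set_egf S1) * in_y (set_egf S2) :: 'a::field_char_0 fps fps"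
  shows "1 / F = inverse F" and "F * (1 / F) = 1"
proof -
  have F0: "fps_nth F 0 = 1"
    using assms(1) by (auto simp: F_def in_x_def in_y_def set_egf_def)
  then have sd: "subdegree F = 0"
    by (intro subdegree_eq_0) simp
  then show eq: "1 / F = inverse F"
    by (simp add: fps_divide_def)
  have "inverse (1 :: 'a fps) = 1"
    by simp
  then have "F * inverse F = 1"
    using F0 fps_right_inverse[of F 1] by (simp add: fps_inverse_def)
  then show "F * (1 / F) = 1"
    by (simp add: eq)
qed

end

theory Submission
  imports Defs
begin

text \<open>
  A \<open>(0,1)\<close>-matrix is lonesum iff its rows, read as sets of columns, form a chain. If such a
  nonempty matrix has no zero rows and columns, its full rows \<open>R\<close> form one row type, the columns
  \<open>C\<close> whose only ones lie in \<open>R\<close> form one column type, both are nonempty, and deleting them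
  leaves an arbitrary smaller matrix of the same kind. This gives \<open>L = 1 + E\<^sub>1 E\<^sub>2 L\<close>. Working with
  relations on arbitrary finite sets of rows and columns avoids renumbering after the deletion.
\<close>

section \<open>Relations with nested rows\<close>

text \<open>The forbidden pattern is a 2x2 submatrix that is a permutation matrix. Relations
  avoiding it are known as Ferrers relations.\<close>

definition no_switch :: "('a \<times> 'b) set \<Rightarrow> bool" where
  "no_switch P \<longleftrightarrow>
     (\<forall>i i' j j'. (i, j) \<in> P \<and> (i', j') \<in> P \<longrightarrow> (i, j') \<in> P \<or> (i', j) \<in> P)"

definition classes_in :: "nat set \<Rightarrow> 'a set \<Rightarrow> ('a \<Rightarrow> 'c) \<Rightarrow> bool" where
  "classes_in S A f \<longleftrightarrow> (\<forall>i\<in>A. card {i' \<in> A. f i' = f i} \<in> S)"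

text \<open>The equations for \<open>Domain P\<close> and \<open>Range P\<close> do double duty:
  they confine \<open>P\<close> to the given rows and columns, and they rule out zero rows and
  columns.\<close>

definition staircases :: "nat set \<Rightarrow> nat set \<Rightarrow> 'a set \<Rightarrow> 'b set \<Rightarrow> ('a \<times> 'b) set set" where
  "staircases S1 S2 A B = {P. no_switch P \<and> Domain P = A \<and> Range P = B \<and>
     classes_in S1 A (\<lambda>i. P `` {i}) \<and> classes_in S2 B (\<lambda>j. P\<inverse> `` {j})}"

lemma no_switch_nested:
  assumes "no_switch P"
  shows "P `` {i} \<subseteq> P `` {i'} \<or> P `` {i'} \<subseteq> P `` {i}"
  using assms unfolding no_switch_def by blast

text \<open>Nested finite rows are ordered by their sizes, so a row of maximal size contains all
  others. Rows outside \<open>A\<close> are empty, which lets \<open>i'\<close> range over the whole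
  type.\<close>

lemma no_switch_greatest_row:
  assumes "no_switch P" "P \<subseteq> A \<times> B" "finite A" "finite B" "A \<noteq> {}"
  obtains i where "i \<in> A" "\<And>i'. P `` {i'} \<subseteq> P `` {i}"
proof -
  have fin: "finite (P `` {i})" for i
    using assms(2,4) by (auto intro: finite_subset)
  let ?M = "Max ((\<lambda>i. card (P `` {i})) ` A)"
  have "?M \<in> (\<lambda>i. card (P `` {i})) ` A"
    using assms(3,5) by (intro Max_in) auto
  then obtain i where i: "i \<in> A" "card (P `` {i}) = ?M"
    by auto
  have "P `` {i'} \<subseteq> P `` {i}" for i'
  proof (cases "i' \<in> A")
    case True
    then have "card (P `` {i'}) \<le> card (P `` {i})"
      using i assms(3) by simp
    then show ?thesis
      using no_switch_nested[OF assms(1), of i i'] fin card_seteq by metis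
  next
    case False
    then show ?thesis
      using assms(2) by auto
  qed
  then show thesis
    using i that by blast
qed

text \<open>Complementing and transposing both carry the forbidden pattern to itself. Together they
  turn a result on a greatest row into one on a least column.\<close>

lemma no_switch_complement:
  "no_switch P \<Longrightarrow> no_switch ((A \<times> B - P)\<inverse>)"
  unfolding no_switch_def by blast

lemma no_switch_full_row:
  assumes "no_switch P" "Domain P = A" "Range P = B" "finite A" "finite B" "A \<noteq> {}"
  obtains i where "i \<in> A" "P `` {i} = B"
proof -
  have sub: "P \<subseteq> A \<times> B"
    using assms(2,3) by auto
  obtain i where "i \<in> A" "\<And>i'. P `` {i'} \<subseteq> P `` {i}"
    using no_switch_greatest_row[OF assms(1) sub assms(4-6)] by metis
  \<comment> \<open>Every column has a one in some row, and the greatest row contains that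
    row.\<close>
  then have "P `` {i} = B"
    using assms(3) by blast
  with \<open>i \<in> A\<close> show thesis
    by (rule that)
qed

text \<open>The greatest column of the complement is least in \<open>P\<close>. A row meeting the
  least column meets every column, so the ones of that column sit exactly in the full rows.\<close>

lemma no_switch_least_column:
  assumes "no_switch P" "Domain P = A" "Range P = B" "finite A" "finite B" "B \<noteq> {}"
  obtains j where "j \<in> B" "P\<inverse> `` {j} = {i. P `` {i} = B}"
proof -
  have sub: "(A \<times> B - P)\<inverse> \<subseteq> B \<times> A"
    by auto
  obtain j where j: "j \<in> B" "\<And>j'. (A \<times> B - P)\<inverse> `` {j'} \<subseteq> (A \<times> B - P)\<inverse> `` {j}"
    using no_switch_greatest_row[OF no_switch_complement[OF assms(1)] sub assms(5,4,6)] by metis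
  have "P `` {i} = B" if "(i, j) \<in> P" for i
    using that j assms(2,3) by blast
  then have "P\<inverse> `` {j} = {i. P `` {i} = B}"
    using \<open>j \<in> B\<close> by auto
  with \<open>j \<in> B\<close> show thesis
    by (rule that)
qed

section \<open>Removing the full rows and the least columns\<close>

lemma staircases_empty: "staircases S1 S2 {} {} = {{}}"
  by (auto simp: staircases_def no_switch_def classes_in_def)

lemma finite_staircases:
  assumes "finite A" "finite B"
  shows "finite (staircases S1 S2 A B)"
proof (rule finite_subset)
  show "staircases S1 S2 A B \<subseteq> Pow (A \<times> B)"
    by (auto simp: staircases_def)
qed (use assms in auto)

text \<open>\<open>R\<close> is the fibre of \<open>f\<close> over \<open>c\<close>, and off
  \<open>R\<close> the maps \<open>f\<close> and \<open>g\<close> induce the same partition. Since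
  \<open>R\<close> is nonempty, its size really is one of those tested on the left.\<close>

lemma classes_in_split:
  assumes "R \<subseteq> A" "R \<noteq> {}" "\<And>i. i \<in> R \<Longrightarrow> f i = c" "\<And>i. i \<in> A - R \<Longrightarrow> f i \<noteq> c"
    and "\<And>i i'. i \<in> A - R \<Longrightarrow> i' \<in> A - R \<Longrightarrow> f i = f i' \<longleftrightarrow> g i = g i'"
  shows "classes_in S A f \<longleftrightarrow> card R \<in> S \<and> classes_in S (A - R) g"
proof -
  have 1: "{i' \<in> A. f i' = f i} = R" if "i \<in> R" for i
    using that assms by blast
  have 2: "{i' \<in> A. f i' = f i} = {i' \<in> A - R. g i' = g i}" if "i \<in> A - R" for i
    using that assms(3-5) by (smt (verit) Collect_cong DiffD1 DiffI)
  have "classes_in S A f \<longleftrightarrow> (\<forall>i\<in>R. card {i' \<in> A. f i' = f i} \<in> S) \<and>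
          (\<forall>i\<in>A-R. card {i' \<in> A. f i' = f i} \<in> S)"
    using assms(1) unfolding classes_in_def by blast
  then show ?thesis
    using 1 2 assms(2) by (auto simp: classes_in_def)
qed

text \<open>Rows in \<open>R\<close> are full, while the others miss the nonempty \<open>C\<close>.
  Columns in \<open>C\<close> equal \<open>R\<close>, while the others also contain a nonempty
  column of \<open>Q\<close>. So \<open>R\<close> and \<open>C\<close> are complete types, and the
  remaining rows and columns coincide in \<open>P\<close> exactly when they do in
  \<open>Q\<close>.\<close>

lemma staircases_extend_iff:
  fixes A :: "'a set" and B :: "'b set"
  assumes "R \<subseteq> A" "R \<noteq> {}" "C \<subseteq> B" "C \<noteq> {}"
    and Q: "Domain Q = A - R" "Range Q = B - C"
  defines "P \<equiv> R \<times> B \<union> Q"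
  shows "P \<in> staircases S1 S2 A B \<longleftrightarrow>
           card R \<in> S1 \<and> card C \<in> S2 \<and> Q \<in> staircases S1 S2 (A - R) (B - C)"
proof -
  have Qsub: "i \<in> A - R \<and> j \<in> B - C" if "(i, j) \<in> Q" for i j
    using that Q by blast
  have "B \<noteq> {}"
    using assms by auto
  then have dom: "Domain P = A" "Range P = B"
    using assms(1-4) Q by (auto simp: P_def Domain_Un_eq Range_Un_eq)
  have sw: "no_switch P \<longleftrightarrow> no_switch Q"
    unfolding no_switch_def P_def using Qsub by blast
  have rowR: "P `` {i} = B" if "i \<in> R" for i
    using that Qsub by (auto simp: P_def)
  have rowN: "P `` {i} = Q `` {i}" if "i \<in> A - R" for i
    using that by (auto simp: P_def)
  have rowN': "P `` {i} \<noteq> B" if "i \<in> A - R" for i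
    using rowN[OF that] Qsub assms(3,4) by blast
  have colC: "P\<inverse> `` {j} = R" if "j \<in> C" for j
    using that Qsub assms(3) by (auto simp: P_def)
  have colN: "P\<inverse> `` {j} = R \<union> Q\<inverse> `` {j}" if "j \<in> B - C" for j
    using that by (auto simp: P_def)
  have disj: "R \<inter> Q\<inverse> `` {j} = {}" for j
    using Qsub by blast
  have colN': "P\<inverse> `` {j} \<noteq> R" if "j \<in> B - C" for j
    using colN[OF that] disj[of j] that Q(2) by blast
  have colE: "P\<inverse> `` {j} = P\<inverse> `` {j'} \<longleftrightarrow> Q\<inverse> `` {j} = Q\<inverse> `` {j'}"
    if "j \<in> B - C" "j' \<in> B - C" for j j'
    using colN[OF that(1)] colN[OF that(2)] disj[of j] disj[of j'] by blast
  have "classes_in S1 A (\<lambda>i. P `` {i}) \<longleftrightarrow>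
          card R \<in> S1 \<and> classes_in S1 (A - R) (\<lambda>i. Q `` {i})"
    by (rule classes_in_split[where c = B]) (use assms rowR rowN rowN' in auto)
  moreover have "classes_in S2 B (\<lambda>j. P\<inverse> `` {j}) \<longleftrightarrow>
          card C \<in> S2 \<and> classes_in S2 (B - C) (\<lambda>j. Q\<inverse> `` {j})"
    by (rule classes_in_split[where c = R]) (use assms colC colE colN' in auto)
  ultimately show ?thesis
    using dom Q sw by (auto simp: staircases_def)
qed

text \<open>One deletion step is reversible. As 0 is in neither \<open>S1\<close> nor
  \<open>S2\<close>, the sets \<open>R\<close> and \<open>C\<close> are nonempty, so both can be
  read off the glued relation.\<close>

lemma bij_betw_staircases:
  fixes A :: "'a set" and B :: "'b set"
  assumes "finite A" "finite B" "A \<noteq> {} \<or> B \<noteq> {}" "0 \<notin> S1" "0 \<notin> S2"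
  shows "bij_betw (\<lambda>((R, C), Q). R \<times> B \<union> Q)
           (SIGMA (R, C) : {R. R \<subseteq> A \<and> card R \<in> S1} \<times> {C. C \<subseteq> B \<and> card C \<in> S2}.
              staircases S1 S2 (A - R) (B - C))
           (staircases S1 S2 A B)" (is "bij_betw ?f ?T _")
proof -
  \<comment> \<open>The inverse map: \<open>R\<close> is recovered as the set of full rows,
    \<open>C\<close> as the set of columns whose ones are exactly in the full rows.\<close>
  define rows where "rows P = {i. P `` {i} = B}" for P :: "('a \<times> 'b) set"
  define cols where "cols P = {j \<in> B. P\<inverse> `` {j} = rows P}" for P :: "('a \<times> 'b) set"
  define g where "g P = ((rows P, cols P), P - rows P \<times> B)" for P :: "('a \<times> 'b) set"
  have fw: "?f t \<in> staircases S1 S2 A B \<and> g (?f t) = t" if "t \<in> ?T" for t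
  proof -
    obtain R C Q where t: "t = ((R, C), Q)"
      by (metis prod.exhaust)
    have R: "R \<subseteq> A" "R \<noteq> {}" "card R \<in> S1" and C: "C \<subseteq> B" "C \<noteq> {}" "card C \<in> S2"
      and Q: "Q \<in> staircases S1 S2 (A - R) (B - C)"
      using that assms(4,5) unfolding t by auto
    have Q': "Domain Q = A - R" "Range Q = B - C"
      using Q by (auto simp: staircases_def)
    have Qsub: "i \<in> A - R \<and> j \<in> B - C" if "(i, j) \<in> Q" for i j
      using that Q' by blast
    let ?P = "R \<times> B \<union> Q"
    have r: "rows ?P = R"
    proof
      show "rows ?P \<subseteq> R"
        unfolding rows_def using C Qsub by blast
      show "R \<subseteq> rows ?P"
        unfolding rows_def using Qsub by blast
    qed
    have c: "cols ?P = C"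
    proof
      show "cols ?P \<subseteq> C"
        unfolding cols_def r using Q'(2) Qsub by blast
      show "C \<subseteq> cols ?P"
        unfolding cols_def r using C Qsub by blast
    qed
    have "?P - R \<times> B = Q"
      using Qsub by blast
    then show ?thesis
      using staircases_extend_iff[OF R(1,2) C(1,2) Q', of S1 S2] R C Q
      by (simp add: t g_def r c)
  qed
  have bw: "g P \<in> ?T \<and> ?f (g P) = P" if "P \<in> staircases S1 S2 A B" for P
  proof -
    have P: "no_switch P" "Domain P = A" "Range P = B"
      using that by (auto simp: staircases_def)
    have ne: "A \<noteq> {}" "B \<noteq> {}"
      using P assms(3) by auto
    let ?R = "rows P" and ?C = "cols P" and ?Q = "P - rows P \<times> B"
    obtain i where "i \<in> A" "P `` {i} = B"
      using no_switch_full_row[OF P assms(1,2) ne(1)] .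
    \<comment> \<open>With \<open>B\<close> empty every element of the type would count as a full
      row, so \<open>ne\<close> is used to place \<open>rows P\<close> inside
      \<open>A\<close>.\<close>
    then have R: "?R \<subseteq> A" "?R \<noteq> {}"
      using P ne by (auto simp: rows_def)
    obtain j where "j \<in> B" "P\<inverse> `` {j} = ?R"
      using no_switch_least_column[OF P assms(1,2) ne(2)] unfolding rows_def .
    then have C: "?C \<subseteq> B" "?C \<noteq> {}"
      by (auto simp: cols_def)
    have sub: "?R \<times> B \<subseteq> P"
      by (auto simp: rows_def)
    have dom: "Domain ?Q = A - ?R"
      using P(2,3) sub by blast
    have ran: "Range ?Q = B - ?C"
    proof
      show "Range ?Q \<subseteq> B - ?C"
        using P(3) by (auto simp: cols_def)
      show "B - ?C \<subseteq> Range ?Q"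
      proof
        \<comment> \<open>Column \<open>j\<close> contains all full rows without being equal to
          their set, so it keeps a one after their deletion.\<close>
        fix j assume j: "j \<in> B - ?C"
        then have "?R \<subseteq> P\<inverse> `` {j}" "P\<inverse> `` {j} \<noteq> ?R"
          using sub by (auto simp: cols_def)
        then show "j \<in> Range ?Q"
          by blast
      qed
    qed
    have eq: "?R \<times> B \<union> ?Q = P"
      using sub by blast
    show ?thesis
      using staircases_extend_iff[OF R C dom ran, of S1 S2] that eq R C
      by (simp add: g_def)
  qed
  show ?thesis
  proof (rule bij_betw_byWitness[where f' = g])
    show "\<forall>t\<in>?T. g (?f t) = t"
      by (intro ballI conjunct2[OF fw])
    show "?f ` ?T \<subseteq> staircases S1 S2 A B"
      by (intro image_subsetI conjunct1[OF fw])
    show "\<forall>P\<in>staircases S1 S2 A B. ?f (g P) = P"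
      by (intro ballI conjunct2[OF bw])
    show "g ` staircases S1 S2 A B \<subseteq> ?T"
      by (intro image_subsetI conjunct1[OF bw])
  qed
qed

lemma card_staircases:
  assumes "finite A" "finite B" "A \<noteq> {} \<or> B \<noteq> {}" "0 \<notin> S1" "0 \<notin> S2"
  shows "card (staircases S1 S2 A B) =
           (\<Sum>R | R \<subseteq> A \<and> card R \<in> S1. \<Sum>C | C \<subseteq> B \<and> card C \<in> S2.
              card (staircases S1 S2 (A - R) (B - C)))"
proof -
  have fin: "finite ({R. R \<subseteq> A \<and> card R \<in> S1} \<times> {C. C \<subseteq> B \<and> card C \<in> S2})"
    using assms(1,2) by auto
  show ?thesis
    unfolding bij_betw_same_card[OF bij_betw_staircases[OF assms], symmetric]
    using fin assms(1,2)
    by (subst card_SigmaI) (auto simp: finite_staircases sum.cartesian_product case_prod_unfold)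
qed

section \<open>Comparison of coefficients\<close>

lemma sum_subsets_by_card:
  fixes h :: "nat \<Rightarrow> 'a::comm_semiring_1"
  assumes "finite A"
  shows "(\<Sum>R | R \<subseteq> A \<and> card R \<in> S. h (card R)) =
           (\<Sum>a\<le>card A. if a \<in> S then of_nat (card A choose a) * h a else 0)"
proof -
  have "(\<Sum>R | R \<subseteq> A \<and> card R \<in> S. h (card R)) = (\<Sum>R\<in>Pow A. if card R \<in> S then h (card R) else 0)"
    using assms by (intro sum.mono_neutral_cong_left) auto
  also have "\<dots> = (\<Sum>a\<le>card A. \<Sum>R | R \<in> Pow A \<and> card R = a. if card R \<in> S then h (card R) else 0)"
    using assms by (intro sum.group[symmetric]) (auto intro: card_mono)
  also have "\<dots> = (\<Sum>a\<le>card A. if a \<in> S then of_nat (card A choose a) * h a else 0)"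
    using n_subsets[OF assms] by (intro sum.cong) auto
  finally show ?thesis .
qed

section \<open>The matching recurrence for the power series\<close>

lemma set_egf_mult_nth:
  "fps_nth (set_egf S * f) k = (\<Sum>b\<le>k. if b \<in> S then 1 / fact b * fps_nth f (k - b) else 0)"
  by (auto simp: fps_mult_nth set_egf_def atLeast0AtMost intro!: sum.cong)

lemma in_x_set_egf_mult_nth:
  "fps_nth (in_x (set_egf S) * F) n =
     (\<Sum>a\<le>n. if a \<in> S then fps_const (1 / fact a) * fps_nth F (n - a) else 0)"
  by (auto simp: fps_mult_nth in_x_def set_egf_def atLeast0AtMost intro!: sum.cong)

text \<open>\<open>G\<close> solves \<open>G = 1 + E1 E2 G\<close>, and coefficients are compared.
  Positivity of \<open>S1\<close> gives the divisor the coefficient 1 at \<open>x^0\<close>, so the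
  division is a true one.\<close>

lemma inverse_egf_recurrence:
  fixes S1 S2 :: "nat set"
  assumes "S1 \<subseteq> {0<..}"
  defines "G \<equiv> 1 / (1 - in_x (set_egf S1) * in_y (set_egf S2)) :: 'a::field_char_0 fps fps"
  shows "fps_nth (fps_nth G n) k = (if n = 0 \<and> k = 0 then 1 else 0) +
           (\<Sum>a\<le>n. if a \<in> S1 then 1 / fact a *
              (\<Sum>b\<le>k. if b \<in> S2 then 1 / fact b * fps_nth (fps_nth G (n - a)) (k - b) else 0)
            else 0)"
proof -
  have "(1 - in_x (set_egf S1) * in_y (set_egf S2)) * G = 1"
    unfolding G_def by (rule one_minus_set_egf_unit(2)[OF assms(1)])
  \<comment> \<open>This bracketing makes the product in \<open>x\<close> the outer convolution and
    the product in \<open>y\<close> the inner one.\<close>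
  then have eq: "1 + in_x (set_egf S1) * (in_y (set_egf S2) * G) = G"
    by (simp add: algebra_simps)
  have inner: "fps_nth (in_y (set_egf S2) * G) m = set_egf S2 * fps_nth G m" for m
    by (simp add: in_y_def)
  have "fps_nth (fps_nth (1 + in_x (set_egf S1) * (in_y (set_egf S2) * G)) n) k =
      (if n = 0 \<and> k = 0 then 1 else 0) +
      (\<Sum>a\<le>n. fps_nth (if a \<in> S1 then fps_const (1 / fact a) *
          (set_egf S2 * fps_nth G (n - a)) else 0) k)"
    by (simp add: in_x_set_egf_mult_nth inner fps_sum_nth cong: if_cong)
  also have "\<dots> = (if n = 0 \<and> k = 0 then 1 else 0) +
           (\<Sum>a\<le>n. if a \<in> S1 then 1 / fact a *
              (\<Sum>b\<le>k. if b \<in> S2 then 1 / fact b * fps_nth (fps_nth G (n - a)) (k - b) else 0)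
            else 0)"
    by (intro arg_cong2[of _ _ _ _ "(+)"] sum.cong refl)
      (simp add: set_egf_mult_nth)
  finally show ?thesis
    unfolding eq .
qed

text \<open>Divided by the two factorials, the counts obey the same recurrence as the coefficients
  of \<open>G\<close>. Induction on \<open>card A\<close> with arbitrary \<open>B\<close> suffices,
  because each step deletes a nonempty set of rows.\<close>

lemma card_staircases_egf:
  fixes A :: "'b set" and B :: "'c set" and S1 S2 :: "nat set"
  assumes "S1 \<subseteq> {0<..}" "S2 \<subseteq> {0<..}" "finite A" "finite B"
  defines "G \<equiv> 1 / (1 - in_x (set_egf S1) * in_y (set_egf S2)) :: 'a::field_char_0 fps fps"
  shows "of_nat (card (staircases S1 S2 A B)) =
           fact (card A) * fact (card B) * fps_nth (fps_nth G (card A)) (card B)"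
  using assms(3,4)
proof (induction "card A" arbitrary: A B rule: less_induct)
  case less
  note rec = inverse_egf_recurrence[OF assms(1), where 'a = 'a and n = "card A" and k = "card B"
      and ?S2.0 = S2, folded G_def]
  show ?case
  proof (cases "A = {} \<and> B = {}")
    case True
    \<comment> \<open>Only \<open>a = 0\<close> is left in the sum and is excluded here; the
      coefficient is then 1, matching the single empty relation.\<close>
    moreover have "0 \<notin> S1"
      using assms(1) by auto
    ultimately show ?thesis
      using rec by (simp add: staircases_empty)
  next
    case False
    let ?n = "card A" and ?k = "card B"
    let ?c = "\<lambda>a b. fact (?n - a) * fact (?k - b) * fps_nth (fps_nth G (?n - a)) (?k - b)"
    have step: "of_nat (card (staircases S1 S2 (A - R) (B - C))) = ?c (card R) (card C)"
      if "R \<subseteq> A" "card R \<in> S1" "C \<subseteq> B" for R C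
    proof -
      have "finite R" "finite C"
        using that less.prems by (auto intro: finite_subset)
      then have c: "card (A - R) = ?n - card R" "card (B - C) = ?k - card C"
        using that by (auto intro: card_Diff_subset)
      have "0 < card R" "card R \<le> ?n"
        using that assms(1) less.prems by (auto intro: card_mono)
      then have "card (A - R) < ?n"
        using c by simp
      then show ?thesis
        using less.hyps[of "A - R" "B - C"] less.prems c by simp
    qed
    \<comment> \<open>The factorials from the induction hypothesis cancel against the binomials,
      leaving the weights \<open>1 / fact a\<close> and \<open>1 / fact b\<close> of the
      series.\<close>
    have bin: "of_nat (m choose a) * fact (m - a) = (fact m / fact a :: 'a)" if "a \<le> m" for m a
      using that by (simp add: binomial_fact)
    have zero: "0 \<notin> S1" "0 \<notin> S2"
      using assms(1,2) by auto
    have "of_nat (card (staircases S1 S2 A B)) =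
        (\<Sum>R | R \<subseteq> A \<and> card R \<in> S1. \<Sum>C | C \<subseteq> B \<and> card C \<in> S2.
           of_nat (card (staircases S1 S2 (A - R) (B - C))))"
      using card_staircases[of A B S1 S2] less.prems False zero by simp
    also have "\<dots> = (\<Sum>R | R \<subseteq> A \<and> card R \<in> S1. \<Sum>C | C \<subseteq> B \<and> card C \<in> S2. ?c (card R) (card C))"
      using step by (intro sum.cong refl) auto
    also have "\<dots> = (\<Sum>a\<le>?n. if a \<in> S1 then of_nat (?n choose a) *
        (\<Sum>b\<le>?k. if b \<in> S2 then of_nat (?k choose b) * ?c a b else 0) else 0)"
      unfolding sum_subsets_by_card[OF less.prems(2), where h = "?c a" for a]
      by (rule sum_subsets_by_card[OF less.prems(1)])
    also have "\<dots> = (\<Sum>a\<le>?n. if a \<in> S1 then fact ?n * (1 / fact a) *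
        (\<Sum>b\<le>?k. if b \<in> S2 then fact ?k * (1 / fact b * fps_nth (fps_nth G (?n - a)) (?k - b)) else 0) else 0)"
    proof (intro sum.cong refl if_cong)
      fix a assume a: "a \<in> {..?n}"
      have "of_nat (?n choose a) * (\<Sum>b\<le>?k. if b \<in> S2 then of_nat (?k choose b) * ?c a b else 0)
        = (of_nat (?n choose a) * fact (?n - a)) * (\<Sum>b\<le>?k. if b \<in> S2 then
             (of_nat (?k choose b) * fact (?k - b)) * fps_nth (fps_nth G (?n - a)) (?k - b) else 0)"
        unfolding sum_distrib_left by (intro sum.cong) (auto simp: mult_ac)
      also have "\<dots> = fact ?n * (1 / fact a) * (\<Sum>b\<le>?k. if b \<in> S2 then
          fact ?k * (1 / fact b * fps_nth (fps_nth G (?n - a)) (?k - b)) else 0)"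
        using a bin[of _ ?k] bin[of a ?n] by (auto intro!: arg_cong2[of _ _ _ _ "(*)"] sum.cong)
      finally show "of_nat (?n choose a) *
          (\<Sum>b\<le>?k. if b \<in> S2 then of_nat (?k choose b) * ?c a b else 0) = \<dots>" .
    qed
    also have "\<dots> = fact ?n * fact ?k * (\<Sum>a\<le>?n. if a \<in> S1 then 1 / fact a *
        (\<Sum>b\<le>?k. if b \<in> S2 then 1 / fact b * fps_nth (fps_nth G (?n - a)) (?k - b) else 0) else 0)"
      unfolding sum_distrib_left by (intro sum.cong refl) (auto simp: sum_distrib_left intro!: sum.cong)
    also have "\<dots> = fact ?n * fact ?k * fps_nth (fps_nth G ?n) ?k"
      using rec False less.prems by auto
    finally show ?thesis .
  qed
qed

section \<open>Lonesum matrices\<close>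

text \<open>The index bounds belong to the set because \<open>$$\<close> outside the dimensions
  carries no information.\<close>

definition mat_support :: "nat mat \<Rightarrow> (nat \<times> nat) set" where
  "mat_support M = {(i, j). i < dim_row M \<and> j < dim_col M \<and> M $$ (i, j) = 1}"

lemma zero_one_mat_iff:
  "zero_one_mat M \<longleftrightarrow> (\<forall>i<dim_row M. \<forall>j<dim_col M. M $$ (i, j) \<in> {0, 1})"
proof
  assume "zero_one_mat M"
  then show "\<forall>i<dim_row M. \<forall>j<dim_col M. M $$ (i, j) \<in> {0, 1}"
    unfolding zero_one_mat_def by blast
next
  assume r: "\<forall>i<dim_row M. \<forall>j<dim_col M. M $$ (i, j) \<in> {0, 1}"
  show "zero_one_mat M"
    unfolding zero_one_mat_def
  proof
    fix x assume "x \<in> elements_mat M"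
    then show "x \<in> {0, 1}"
      using r by fastforce
  qed
qed

text \<open>Since rows are nested by size, a row at least as large as one meeting column
  \<open>j\<close> meets it too. Hence \<open>t j\<close> can be the least size of a row meeting
  \<open>j\<close>.\<close>

lemma no_switch_threshold:
  assumes "no_switch P" "finite P"
  obtains t :: "'b \<Rightarrow> nat" where "\<And>i j. (i, j) \<in> P \<longleftrightarrow> t j \<le> card (P `` {i})"
proof -
  have fin: "finite (P `` {i})" for i
    using assms(2) by (rule finite_Image)
  have "\<exists>t. \<forall>i. (i, j) \<in> P \<longleftrightarrow> t \<le> card (P `` {i})" for j
  proof (cases "\<exists>i. (i, j) \<in> P")
    case True
    let ?D = "\<lambda>t. \<exists>i. (i, j) \<in> P \<and> card (P `` {i}) = t"
    have "\<exists>t. ?D t" using True by blast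
    then obtain i where i: "(i, j) \<in> P" "card (P `` {i}) = (LEAST t. ?D t)"
      using LeastI_ex[of ?D] by blast
    have "(i', j) \<in> P \<longleftrightarrow> card (P `` {i}) \<le> card (P `` {i'})" for i'
    proof
      assume "(i', j) \<in> P"
      then show "card (P `` {i}) \<le> card (P `` {i'})"
        unfolding i(2) by (intro Least_le) blast
    next
      assume "card (P `` {i}) \<le> card (P `` {i'})"
      then have "P `` {i} \<subseteq> P `` {i'}"
        using no_switch_nested[OF assms(1), of i i'] fin card_seteq by metis
      then show "(i', j) \<in> P"
        using i(1) by blast
    qed
    then show ?thesis by blast
  next
    case False
    have "card (P `` {i}) \<le> card (Range P)" for i
      using assms(2) by (intro card_mono) (auto intro: finite_Range)
    \<comment> \<open>A column without ones gets a threshold above every row size.\<close>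
    then have "\<forall>i. (i, j) \<in> P \<longleftrightarrow> Suc (card (Range P)) \<le> card (P `` {i})"
      using False by (meson not_less_eq_eq)
    then show ?thesis by blast
  qed
  then show thesis
    using that by metis
qed

lemma finite_mat_support: "finite (mat_support M)"
  by (rule finite_subset[of _ "{..<dim_row M} \<times> {..<dim_col M}"]) (auto simp: mat_support_def)

text \<open>The weights \<open>2 * u i - 2 * t j + 1\<close> are positive exactly on the support of \<open>A\<close>, so \<open>A\<close> is
  the only maximiser of the weighted sum of entries, which depends on row and column sums alone.\<close>

lemma no_switch_imp_lonesum:
  assumes "zero_one_mat A" "no_switch (mat_support A)"
  shows "lonesum A"
  unfolding lonesum_def
proof (intro conjI ballI impI)
  fix B assume B: "B \<in> carrier_mat (dim_row A) (dim_col A)"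
    and "zero_one_mat B \<and> row_sums B = row_sums A \<and> col_sums B = col_sums A"
  then have zB: "zero_one_mat B" and rs: "row_sums B = row_sums A" and cs: "col_sums B = col_sums A"
    by auto
  define n k where "n = dim_row A" and "k = dim_col A"
  have d: "dim_row B = n" "dim_col B = k"
    using B by (auto simp: n_def k_def)
  obtain t where t: "\<And>i j. (i, j) \<in> mat_support A \<longleftrightarrow> t j \<le> card (mat_support A `` {i})"
    using no_switch_threshold[OF assms(2) finite_mat_support] by metis
  define u where "u i = card (mat_support A `` {i})" for i
  define D where "D i j = int (A $$ (i, j)) - int (B $$ (i, j))" for i j
  \<comment> \<open>The odd summand keeps the weight nonzero and makes a tie
    \<open>t j = u i\<close> count as positive, as \<open>t\<close> requires.\<close>
  define w where "w i j = 2 * int (u i) - 2 * int (t j) + 1" for i j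
  have row: "(\<Sum>j<k. D i j) = 0" if "i < n" for i
    using arg_cong[OF rs, of "\<lambda>v. v $ i"] that d
    by (simp add: row_sums_def D_def sum_subtractf n_def k_def flip: of_nat_sum)
  have col: "(\<Sum>i<n. D i j) = 0" if "j < k" for j
    using arg_cong[OF cs, of "\<lambda>v. v $ j"] that d
    by (simp add: col_sums_def D_def sum_subtractf n_def k_def flip: of_nat_sum)
  \<comment> \<open>The weight is a function of the row plus a function of the column, so the sum
    splits into multiples of the vanishing \<open>row\<close> and \<open>col\<close> sums.\<close>
  have "(\<Sum>i<n. \<Sum>j<k. D i j * w i j) =
      (\<Sum>i<n. (2 * int (u i) + 1) * (\<Sum>j<k. D i j)) - (\<Sum>i<n. \<Sum>j<k. 2 * int (t j) * D i j)"
    by (simp add: sum_distrib_left w_def algebra_simps flip: sum_subtractf sum.distrib)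
  also have "(\<Sum>i<n. \<Sum>j<k. 2 * int (t j) * D i j) = (\<Sum>j<k. 2 * int (t j) * (\<Sum>i<n. D i j))"
    by (subst sum.swap) (simp add: sum_distrib_left)
  finally have zero: "(\<Sum>(i, j)\<in>{..<n} \<times> {..<k}. D i j * w i j) = 0"
    using row col by (simp add: sum.cartesian_product)
  \<comment> \<open>Where the weight is positive, \<open>A\<close> has a 1 and \<open>D\<close>
    cannot be negative; where it is negative, \<open>A\<close> has a 0 and \<open>D\<close> cannot
    be positive.\<close>
  have pos: "0 \<le> D i j * w i j \<and> (D i j * w i j = 0 \<longrightarrow> A $$ (i, j) = B $$ (i, j))"
    if "i < n" "j < k" for i j
  proof -
    have "A $$ (i, j) \<in> {0, 1}" "B $$ (i, j) \<in> {0, 1}"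
      using assms(1) zB that d by (auto simp: zero_one_mat_iff n_def k_def)
    moreover have "A $$ (i, j) = 1 \<longleftrightarrow> t j \<le> u i"
      using t[of i j] that by (simp add: u_def mat_support_def n_def k_def)
    ultimately show ?thesis
      by (auto simp: D_def w_def) presburger
  qed
  have "\<forall>p\<in>{..<n} \<times> {..<k}. (case p of (i, j) \<Rightarrow> D i j * w i j) = 0"
    using zero pos by (subst (asm) sum_nonneg_eq_0_iff) auto
  then have "A $$ (i, j) = B $$ (i, j)" if "i < n" "j < k" for i j
    using pos[OF that] that by auto
  then show "B = A"
    using d by (intro eq_matI) (auto simp: n_def k_def)
qed (rule assms(1))

text \<open>This is Ryser's interchange: flipping the four entries of a forbidden 2x2 pattern gives
  a different matrix with the same row and column sums.\<close>

lemma lonesum_imp_no_switch: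
  assumes "lonesum A"
  shows "no_switch (mat_support A)"
proof (rule ccontr)
  have zA: "zero_one_mat A"
    using assms by (simp add: lonesum_def)
  assume "\<not> no_switch (mat_support A)"
  then obtain p q r s where "(p, r) \<in> mat_support A" "(q, s) \<in> mat_support A"
      "(p, s) \<notin> mat_support A" "(q, r) \<notin> mat_support A"
    unfolding no_switch_def by blast
  then have b: "p < dim_row A" "q < dim_row A" "r < dim_col A" "s < dim_col A"
    and e: "A $$ (p, r) = 1" "A $$ (q, s) = 1" "A $$ (p, s) = 0" "A $$ (q, r) = 0"
    using zA by (auto simp: mat_support_def zero_one_mat_iff)
  have pq: "p \<noteq> q" and rs: "r \<noteq> s"
    using e by auto
  define B where "B = mat (dim_row A) (dim_col A)
    (\<lambda>(i, j). if i \<in> {p, q} \<and> j \<in> {r, s} then 1 - A $$ (i, j) else A $$ (i, j))"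
  have "zero_one_mat B"
    using zA by (auto simp: zero_one_mat_iff B_def)
  moreover have "row_sums B = row_sums A"
  proof -
    have "(\<Sum>j<dim_col A. B $$ (i, j)) = (\<Sum>j<dim_col A. A $$ (i, j))" if "i < dim_row A" for i
    proof -
      have "(\<Sum>j<dim_col A. B $$ (i, j)) =
          (\<Sum>j\<in>{..<dim_col A} - {r, s}. B $$ (i, j)) + (B $$ (i, r) + B $$ (i, s))"
        using b rs by (subst sum.subset_diff[of "{r, s}"]) auto
      \<comment> \<open>In rows \<open>p\<close> and \<open>q\<close> the two entries are a 1 and a
        0 that trade places; other rows are unchanged.\<close>
      also have "B $$ (i, r) + B $$ (i, s) = A $$ (i, r) + A $$ (i, s)"
        using that b e by (auto simp: B_def)
      also have "(\<Sum>j\<in>{..<dim_col A} - {r, s}. B $$ (i, j)) = (\<Sum>j\<in>{..<dim_col A} - {r, s}. A $$ (i, j))"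
        using that by (intro sum.cong) (auto simp: B_def)
      also have "(\<Sum>j\<in>{..<dim_col A} - {r, s}. A $$ (i, j)) + (A $$ (i, r) + A $$ (i, s)) =
          (\<Sum>j<dim_col A. A $$ (i, j))"
        using b rs by (subst (2) sum.subset_diff[of "{r, s}"]) auto
      finally show ?thesis .
    qed
    then show ?thesis
      by (auto simp: row_sums_def B_def)
  qed
  moreover have "col_sums B = col_sums A"
  proof -
    have "(\<Sum>i<dim_row A. B $$ (i, j)) = (\<Sum>i<dim_row A. A $$ (i, j))" if "j < dim_col A" for j
    proof -
      have "(\<Sum>i<dim_row A. B $$ (i, j)) =
          (\<Sum>i\<in>{..<dim_row A} - {p, q}. B $$ (i, j)) + (B $$ (p, j) + B $$ (q, j))"
        using b pq by (subst sum.subset_diff[of "{p, q}"]) auto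
      also have "B $$ (p, j) + B $$ (q, j) = A $$ (p, j) + A $$ (q, j)"
        using that b e by (auto simp: B_def)
      also have "(\<Sum>i\<in>{..<dim_row A} - {p, q}. B $$ (i, j)) = (\<Sum>i\<in>{..<dim_row A} - {p, q}. A $$ (i, j))"
        using that by (intro sum.cong) (auto simp: B_def)
      also have "(\<Sum>i\<in>{..<dim_row A} - {p, q}. A $$ (i, j)) + (A $$ (p, j) + A $$ (q, j)) =
          (\<Sum>i<dim_row A. A $$ (i, j))"
        using b pq by (subst (2) sum.subset_diff[of "{p, q}"]) auto
      finally show ?thesis .
    qed
    then show ?thesis
      by (auto simp: col_sums_def B_def)
  qed
  moreover have "B \<in> carrier_mat (dim_row A) (dim_col A)"
    by (simp add: B_def)
  ultimately have "B = A"
    using assms by (auto simp: lonesum_def)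
  moreover have "B $$ (p, r) = 0"
    using b e by (simp add: B_def)
  ultimately show False
    using e by simp
qed

section \<open>Counting restricted lonesum matrices through their supports\<close>

lemma restricted_lonesum_iff_staircases:
  assumes "zero_one_mat M"
  shows "M \<in> restricted_lonesum S1 S2 \<longleftrightarrow>
           mat_support M \<in> staircases S1 S2 {..<dim_row M} {..<dim_col M}"
proof -
  let ?P = "mat_support M"
  have zo: "M $$ (i, j) = 0 \<or> M $$ (i, j) = 1" if "i < dim_row M" "j < dim_col M" for i j
    using assms that by (auto simp: zero_one_mat_iff)
  have entry: "M $$ (i, j) = (if (i, j) \<in> ?P then 1 else 0)" if "i < dim_row M" "j < dim_col M" for i j
    using zo[OF that] that by (auto simp: mat_support_def)
  have bd: "i < dim_row M \<and> j < dim_col M" if "(i, j) \<in> ?P" for i j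
    using that by (auto simp: mat_support_def)
  have row: "row M i = row M i' \<longleftrightarrow> ?P `` {i} = ?P `` {i'}" if "i < dim_row M" "i' < dim_row M" for i i'
  proof -
    have "row M i = row M i' \<longleftrightarrow> (\<forall>j<dim_col M. M $$ (i, j) = M $$ (i', j))"
      using that by (auto simp: vec_eq_iff)
    also have "\<dots> \<longleftrightarrow> (\<forall>j<dim_col M. (i, j) \<in> ?P \<longleftrightarrow> (i', j) \<in> ?P)"
      using that by (auto simp: entry)
    also have "\<dots> \<longleftrightarrow> ?P `` {i} = ?P `` {i'}"
      using bd by blast
    finally show ?thesis .
  qed
  have col: "col M j = col M j' \<longleftrightarrow> ?P\<inverse> `` {j} = ?P\<inverse> `` {j'}" if "j < dim_col M" "j' < dim_col M" for j j'
  proof -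
    have "col M j = col M j' \<longleftrightarrow> (\<forall>i<dim_row M. M $$ (i, j) = M $$ (i, j'))"
      using that by (auto simp: vec_eq_iff)
    also have "\<dots> \<longleftrightarrow> (\<forall>i<dim_row M. (i, j) \<in> ?P \<longleftrightarrow> (i, j') \<in> ?P)"
      using that by (auto simp: entry)
    also have "\<dots> \<longleftrightarrow> ?P\<inverse> `` {j} = ?P\<inverse> `` {j'}"
      using bd by blast
    finally show ?thesis .
  qed
  \<comment> \<open>This also covers empty shapes: with no columns, every row is the zero vector and
    the domain is empty.\<close>
  have row0: "row M i = 0\<^sub>v (dim_col M) \<longleftrightarrow> i \<notin> Domain ?P" if "i < dim_row M" for i
    using that by (auto simp: vec_eq_iff entry dest: bd)
  have col0: "col M j = 0\<^sub>v (dim_row M) \<longleftrightarrow> j \<notin> Range ?P" if "j < dim_col M" for j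
    using that by (auto simp: vec_eq_iff entry dest: bd)
  have "lonesum M \<longleftrightarrow> no_switch ?P"
    using no_switch_imp_lonesum[OF assms] lonesum_imp_no_switch by blast
  moreover have "no_zero_row_col M \<longleftrightarrow> Domain ?P = {..<dim_row M} \<and> Range ?P = {..<dim_col M}"
    unfolding no_zero_row_col_def using row0 col0 bd by blast
  moreover have "type_restricted S1 S2 M \<longleftrightarrow> classes_in S1 {..<dim_row M} (\<lambda>i. ?P `` {i}) \<and>
      classes_in S2 {..<dim_col M} (\<lambda>j. ?P\<inverse> `` {j})"
    unfolding type_restricted_def classes_in_def using row col
    by (simp add: Ball_def cong: conj_cong)
  ultimately show ?thesis
    by (auto simp: restricted_lonesum_def staircases_def)
qed

text \<open>A (0,1)-matrix of given size is determined by its support, and every staircase on the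
  index ranges is such a support.\<close>

lemma card_restricted_lonesum:
  "card {M \<in> restricted_lonesum S1 S2. dim_row M = n \<and> dim_col M = k} =
     card (staircases S1 S2 {..<n} {..<k})"
proof (rule bij_betw_same_card)
  let ?L = "{M \<in> restricted_lonesum S1 S2. dim_row M = n \<and> dim_col M = k}"
  let ?m = "\<lambda>P. mat n k (\<lambda>p. if p \<in> P then 1 else 0 :: nat)"
  have L: "zero_one_mat M" if "M \<in> ?L" for M
    using that by (simp add: restricted_lonesum_def lonesum_def)
  have m: "zero_one_mat (?m P)" for P
    by (auto simp: zero_one_mat_iff)
  \<comment> \<open>The domain and range of \<open>P\<close> lie within the index bounds, so no pair
    is lost in passing to an \<open>n\<close> by \<open>k\<close> matrix.\<close>
  have s: "mat_support (?m P) = P" if "P \<in> staircases S1 S2 {..<n} {..<k}" for P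
  proof -
    have "i < n \<and> j < k" if "(i, j) \<in> P" for i j
      using \<open>P \<in> staircases _ _ _ _\<close> that by (auto simp: staircases_def)
    then show ?thesis
      by (auto simp: mat_support_def split: if_splits)
  qed
  show "bij_betw mat_support ?L (staircases S1 S2 {..<n} {..<k})"
  proof (rule bij_betw_byWitness[where f' = ?m])
    show "\<forall>M\<in>?L. ?m (mat_support M) = M"
    proof
      fix M assume M: "M \<in> ?L"
      then show "?m (mat_support M) = M"
        using L[OF M] by (intro eq_matI) (auto simp: mat_support_def zero_one_mat_iff)
    qed
    show "\<forall>P\<in>staircases S1 S2 {..<n} {..<k}. mat_support (?m P) = P"
      using s by blast
    show "mat_support ` ?L \<subseteq> staircases S1 S2 {..<n} {..<k}"
      using L restricted_lonesum_iff_staircases by auto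
    show "?m ` staircases S1 S2 {..<n} {..<k} \<subseteq> ?L"
      using restricted_lonesum_iff_staircases[OF m] s by auto
  qed
qed

theorem theorem9:
  fixes S1 S2 :: "nat set"
  assumes "S1 \<subseteq> {0<..}" and "S2 \<subseteq> {0<..}"
  shows "(lonesum_egf S1 S2 :: 'a::field_char_0 fps fps) =
           1 / (1 - in_x (set_egf S1) * in_y (set_egf S2))"
proof (intro fps_ext)
  fix n k
  let ?L = "{M \<in> restricted_lonesum S1 S2. dim_row M = n \<and> dim_col M = k}"
  have "fps_nth (fps_nth (lonesum_egf S1 S2 :: 'a fps fps) n) k =
      (\<Sum>M\<in>?L. 1 / fact n * (1 / fact k))"
    by (simp add: lonesum_egf_def)
  \<comment> \<open>The summand depends on the size alone, so the coefficient is the number of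
    matrices divided by both factorials.\<close>
  also have "\<dots> = of_nat (card (staircases S1 S2 {..<n} {..<k})) / (fact n * fact k)"
    by (simp add: card_restricted_lonesum)
  also have "\<dots> = fps_nth (fps_nth (1 / (1 - in_x (set_egf S1) * in_y (set_egf S2))) n) k"
    by (simp add: card_staircases_egf[OF assms])
  finally show "fps_nth (fps_nth (lonesum_egf S1 S2 :: 'a fps fps) n) k = \<dots>" .
qed

end
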